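(* Let $p>1$. The constant $2^{1-p}\left(\frac{p}{p-1}\right)^p$ in the inequality \[ \sum_{i=1}^n |m_i-a_i|^p\leq 2^{1-p}\left(\frac{p}{p-1}\right)^p\sum_{i=1}^n x_i^p \qquad (n\ge 1,\ x_1,\ldots,x_n\ge 0) \] cannot be improved. That is, if $C\in\mathbb R$ is such that \[ \sum_{i=1}^n |m_i-a_i|^p\leq C\sum_{i=1}^n x_i^p \] for every positive integer $n$ and all real numbers $x_1,\ldots,x_n\geq 0$, where $a_i=\frac{x_1+\cdots+x_i}{i}$ and $m_i$ is the lower median of $x_1,\ldots,x_i$ for $1\le i\le n$, then \[ C\geq 2^{1-p}\left(\frac{p}{p-1}\right)^p. \]
   Context: Here $p$ is a real number. The lower median of a finite list $x_1,\ldots,x_i$ of real numbers is the smallest real number $a$ such that $\#\{j\in\{1,\ldots,i\}:x_j\leq a\}\geq i/2$; equivalently, it is the $\lceil i/2\rceil$-th smallest term of the list, counted with multiplicity. *)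

theory Defs
  imports "HOL-Analysis.Analysis"
begin

text \<open>A list \<open>x\<^sub>1, \<dots>, x\<^sub>i\<close> is given by the values of \<open>x\<close> on \<open>{1..i}\<close>;
  \<open>x 0\<close> is never used. Only \<open>i \<ge> 1\<close> is meaningful.\<close>

definition mean :: "(nat \<Rightarrow> real) \<Rightarrow> nat \<Rightarrow> real" where
  "mean x i = (\<Sum>j = 1..i. x j) / real i"

definition lower_median :: "(nat \<Rightarrow> real) \<Rightarrow> nat \<Rightarrow> real" where
  "lower_median x i = (LEAST a. real (card {j \<in> {1..i}. x j \<le> a}) \<ge> real i / 2)"

text \<open>The least element above exists, so \<^const>\<open>lower_median\<close> is not an arbitrary value.\<close>

lemma lower_median_least:
  assumes "i \<ge> 1"
  shows "real (card {j \<in> {1..i}. x j \<le> lower_median x i}) \<ge> real i / 2"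
    and "\<And>a. real (card {j \<in> {1..i}. x j \<le> a}) \<ge> real i / 2 \<Longrightarrow> lower_median x i \<le> a"
proof -
  define P where "P a \<longleftrightarrow> real (card {j \<in> {1..i}. x j \<le> a}) \<ge> real i / 2" for a
  define S where "S = {b \<in> x ` {1..i}. P b}"
  have fin: "finite S" by (simp add: S_def)
  have below: "\<exists>b\<in>S. b \<le> a" if "P a" for a
  proof -
    let ?J = "{j \<in> {1..i}. x j \<le> a}"
    have ne: "?J \<noteq> {}"
    proof
      assume "?J = {}"
      then have "card ?J = 0" by (metis card.empty)
      moreover have "real (card ?J) \<ge> real i / 2" using that by (simp only: P_def)
      ultimately show False using assms by linarith
    qed
    define b where "b = Max (x ` ?J)"
    have "b \<in> x ` ?J" unfolding b_def using ne by (intro Max_in) auto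
    then have b: "b \<in> x ` {1..i}" "b \<le> a" by auto
    have "{j \<in> {1..i}. x j \<le> b} = ?J"
      using b(2) by (auto simp: b_def)
    with that have "P b" by (simp add: P_def)
    with b show ?thesis by (auto simp: S_def)
  qed
  have "P (Max (x ` {1..i}))"
  proof -
    have "{j \<in> {1..i}. x j \<le> Max (x ` {1..i})} = {1..i}" by auto
    then show ?thesis by (simp add: P_def)
  qed
  then have "S \<noteq> {}" using below by blast
  then have min: "P (Min S)" using Min_in[OF fin] by (auto simp: S_def)
  have le: "Min S \<le> a" if "P a" for a
    using below[OF that] Min_le[OF fin] by (meson order_trans)
  have eq: "lower_median x i = Min S"
    unfolding lower_median_def by (rule Least_equality) (use min le in \<open>auto simp: P_def\<close>)
  show "real (card {j \<in> {1..i}. x j \<le> lower_median x i}) \<ge> real i / 2"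
    using min by (simp add: eq P_def)
  show "lower_median x i \<le> a" if "real (card {j \<in> {1..i}. x j \<le> a}) \<ge> real i / 2" for a
    using le that by (simp add: eq P_def)
qed

end

theory Submission
  imports Defs "HOL-Real_Asymp.Real_Asymp"
begin

text \<open>
  The extremal sequences interleave zeros with the critical sequence of Hardy's inequality:
  \<open>x\<^sub>2\<^sub>k = k powr (-1/p)\<close> and \<open>x\<^sub>2\<^sub>k\<^sub>+\<^sub>1 = 0\<close>.  At every stage at least half
  of the terms vanish, so every lower median is \<open>0\<close> (\<open>lower_median_eq_0\<close>) and the left-hand side
  of the inequality is the sum of the \<open>p\<close>-th powers of the means.

  Comparison with an integral (\<open>sum_powr_lower_bound\<close>) shows that
  \<open>a\<^sub>2\<^sub>k\<close> and \<open>a\<^sub>2\<^sub>k\<^sub>+\<^sub>1\<close> are both at least about \<open>k powr (-1/p)\<close> times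
  \<open>1 / (2 (1 - 1/p)) = p / (2 (p - 1))\<close>.  Hence the pair contributes at least about \<open>L / k\<close>
  to the left-hand side, where \<open>L = 2 (p / (2 (p - 1))) powr p\<close> is the constant of the theorem, while
  it contributes exactly \<open>1 / k\<close> to \<open>\<Sum> x\<^sub>i powr p\<close>.  The exponent \<open>-1/p\<close> makes these
  contributions harmonic, so their sum diverges; initial terms are therefore negligible and \<open>L\<close>
  is a lower bound for \<open>C\<close> (\<open>ratio_bound_ge_limit\<close>).
\<close>

section \<open>Medians and means of interleaved sequences\<close>

lemma lower_median_eq_0:
  assumes "i \<ge> 1" and nonneg: "\<forall>j\<in>{1..i}. x j \<ge> 0"
    and zeros: "real (card {j \<in> {1..i}. x j = 0}) \<ge> real i / 2"
  shows "lower_median x i = 0"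
proof (rule antisym)
  have "{j \<in> {1..i}. x j \<le> 0} = {j \<in> {1..i}. x j = 0}"
    using nonneg by force
  then show "lower_median x i \<le> 0"
    using lower_median_least(2)[OF \<open>i \<ge> 1\<close>, of x 0] zeros by simp
next
  show "lower_median x i \<ge> 0"
  proof (rule ccontr)
    assume "\<not> lower_median x i \<ge> 0"
    then have empty: "{j \<in> {1..i}. x j \<le> lower_median x i} = {}"
      using nonneg by fastforce
    show False
      using lower_median_least(1)[OF \<open>i \<ge> 1\<close>, of x] \<open>i \<ge> 1\<close> unfolding empty by simp
  qed
qed

definition interleave_zeros :: "(nat \<Rightarrow> real) \<Rightarrow> nat \<Rightarrow> real" where
  "interleave_zeros y j = (if even j then y (j div 2) else 0)"

lemma interleave_zeros_double [simp]: "interleave_zeros y (2 * k) = y k"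
  and interleave_zeros_Suc_double [simp]: "interleave_zeros y (Suc (2 * k)) = 0"
  by (simp_all add: interleave_zeros_def)

text \<open>Zeros occupy the odd positions, and these are at least half of \<open>{1..i}\<close> even for odd \<open>i\<close>;
  the non-strict inequality in the definition of the lower median covers the case of even \<open>i\<close>.\<close>

lemma lower_median_interleave_zeros:
  assumes "i \<ge> 1" and "\<And>k. y k \<ge> 0"
  shows "lower_median (interleave_zeros y) i = 0"
proof (rule lower_median_eq_0)
  let ?Z = "{j \<in> {1..i}. interleave_zeros y j = 0}"
  have "(\<lambda>k. Suc (2 * k)) ` {..<(i + 1) div 2} \<subseteq> ?Z"
    by auto
  then have "card ((\<lambda>k. Suc (2 * k)) ` {..<(i + 1) div 2}) \<le> card ?Z"
    by (intro card_mono) auto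
  moreover have "card ((\<lambda>k. Suc (2 * k)) ` {..<(i + 1) div 2}) = (i + 1) div 2"
    by (subst card_image) (auto simp: inj_on_def)
  ultimately have "i \<le> 2 * card ?Z"
    by linarith
  then show "real (card ?Z) \<ge> real i / 2"
    by linarith
qed (use assms in \<open>auto simp: interleave_zeros_def\<close>)

lemma sum_pairs:
  fixes f :: "nat \<Rightarrow> real"
  shows "(\<Sum>i = 1..2 * N + 1. f i) = f 1 + (\<Sum>k = 1..N. f (2 * k) + f (2 * k + 1))"
  by (induction N) (simp_all add: algebra_simps)

lemma mean_interleave_zeros:
  shows "mean (interleave_zeros y) (2 * k) = (\<Sum>j = 1..k. y j) / (2 * real k)"
    and "mean (interleave_zeros y) (2 * k + 1) = (\<Sum>j = 1..k. y j) / (2 * real k + 1)"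
proof -
  have odd: "(\<Sum>j = 1..2 * k + 1. interleave_zeros y j) = (\<Sum>j = 1..k. y j)"
    unfolding sum_pairs using interleave_zeros_Suc_double[of y 0] by simp
  then have even: "(\<Sum>j = 1..2 * k. interleave_zeros y j) = (\<Sum>j = 1..k. y j)"
    by simp
  show "mean (interleave_zeros y) (2 * k) = (\<Sum>j = 1..k. y j) / (2 * real k)"
    unfolding mean_def even by simp
  show "mean (interleave_zeros y) (2 * k + 1) = (\<Sum>j = 1..k. y j) / (2 * real k + 1)"
    unfolding mean_def odd by (simp add: algebra_simps)
qed

section \<open>Asymptotic tools\<close>

text \<open>The right-hand side is the integral of \<open>t powr (r - 1)\<close> over \<open>{1..k + 1}\<close>; since the
  integrand decreases, its mean value on \<open>{k..k + 1}\<close> is at most its value at \<open>k\<close>.\<close>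

lemma sum_powr_lower_bound:
  fixes r :: real
  assumes "0 < r" "r < 1"
  shows "(\<Sum>j = 1..k. real j powr (r - 1)) \<ge> ((real k + 1) powr r - 1) / r"
proof (induction k)
  case 0
  then show ?case by simp
next
  case (Suc k)
  let ?t = "real k + 1"
  have "\<exists>z>?t. z < ?t + 1 \<and> (?t + 1) powr r - ?t powr r = (?t + 1 - ?t) * (r * z powr (r - 1))"
    by (rule MVT2) (auto intro!: derivative_eq_intros)
  then obtain z where z: "z > ?t" "(?t + 1) powr r - ?t powr r = r * z powr (r - 1)"
    by auto
  have "z powr (r - 1) \<le> ?t powr (r - 1)"
    using z(1) assms by (intro powr_mono2') auto
  then have "r * z powr (r - 1) \<le> r * ?t powr (r - 1)"
    using assms by simp
  then have "((?t + 1) powr r - 1) / r \<le> (?t powr r - 1) / r + ?t powr (r - 1)"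
    using z(2) assms by (simp add: field_simps)
  then show ?case
    using Suc by (simp add: add.commute)
qed

text \<open>A one-sided Stolz--Cesaro argument: for \<open>C < D < L\<close>, all but finitely many terms satisfy
  \<open>b k \<ge> D * c k\<close>, so the assumed bound by \<open>C\<close> would keep \<open>(D - C) * (\<Sum>k = 1..N. c k)\<close> bounded.\<close>

lemma ratio_bound_ge_limit:
  fixes a b c :: "nat \<Rightarrow> real"
  assumes nonneg: "\<And>k. c k \<ge> 0"
    and diverges: "filterlim (\<lambda>N. \<Sum>k = 1..N. c k) at_top sequentially"
    and b_ge: "\<And>k. k \<ge> 1 \<Longrightarrow> b k \<ge> a k * c k"
    and a_lim: "a \<longlonglongrightarrow> L"
    and bound: "\<And>N. (\<Sum>k = 1..N. b k) \<le> C * (\<Sum>k = 1..N. c k)"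
  shows "C \<ge> L"
proof (rule ccontr)
  assume "\<not> C \<ge> L"
  then obtain D where D: "C < D" "D < L"
    using dense[of C L] by auto
  obtain K where K: "\<And>k. k \<ge> K \<Longrightarrow> a k > D"
    using order_tendstoD(1)[OF a_lim D(2)] by (auto simp: eventually_sequentially)
  define M where "M = (\<Sum>k = 1..K. b k - D * c k)"
  have tail: "M \<le> (\<Sum>k = 1..N. b k - D * c k)" if "N \<ge> K" for N
    unfolding M_def
  proof (rule sum_mono2)
    fix k assume k: "k \<in> {1..N} - {1..K}"
    then have "D * c k \<le> a k * c k"
      using K[of k] nonneg[of k] by (intro mult_right_mono) auto
    also have "\<dots> \<le> b k"
      using k b_ge by auto
    finally show "0 \<le> b k - D * c k" by simp
  qed (use that in auto)
  obtain N where N: "N \<ge> K" "(\<Sum>k = 1..N. c k) > - M / (D - C)"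
    using eventually_conj[OF eventually_ge_at_top[of K]
        diverges[unfolded filterlim_at_top_dense, rule_format, of "- M / (D - C)"]]
    by (auto simp: eventually_sequentially)
  have "(\<Sum>k = 1..N. b k - D * c k) = (\<Sum>k = 1..N. b k) - D * (\<Sum>k = 1..N. c k)"
    by (simp add: sum_subtractf sum_distrib_left)
  then have "M \<le> (C - D) * (\<Sum>k = 1..N. c k)"
    using tail[OF N(1)] bound[of N] by (simp add: algebra_simps)
  then show False
    using N(2) D(1) by (simp add: field_simps)
qed

section \<open>Optimality of the constant\<close>

theorem mainTheorem4:
  fixes p C :: real
  assumes "p > 1"
    and "\<And>(n::nat) (x::nat \<Rightarrow> real).
           n \<ge> 1 \<Longrightarrow> (\<forall>i\<in>{1..n}. x i \<ge> 0) \<Longrightarrow>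
           (\<Sum>i = 1..n. \<bar>lower_median x i - mean x i\<bar> powr p) \<le> C * (\<Sum>i = 1..n. x i powr p)"
  shows "C \<ge> 2 powr (1 - p) * (p / (p - 1)) powr p"
proof -
  define r where "r = 1 - 1 / p"
  have r: "0 < r" "r < 1" "r - 1 = - 1 / p"
    using assms(1) by (auto simp: r_def field_simps)
  define y where "y k = real k powr (r - 1)" for k
  define x where "x = interleave_zeros y"
  define b where "b k = mean x (2 * k) powr p + mean x (2 * k + 1) powr p" for k
  \<comment> \<open>\<open>A k * k powr (r - 1)\<close> is a common lower bound for the means at \<open>2 * k\<close> and \<open>2 * k + 1\<close>.\<close>
  define A where "A k = (1 - real k powr (- r)) / r * (real k / (2 * real k + 1))" for k
  have y_nonneg: "y k \<ge> 0" for k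
    by (simp add: y_def)
  have x_nonneg: "x j \<ge> 0" for j
    by (simp add: x_def interleave_zeros_def y_nonneg)
  have y_powr: "y k powr p = inverse (real k)" for k
    proof -
    have "(r - 1) * p = - 1"
      using assms(1) by (simp add: r(3))
    then show ?thesis
      by (simp add: y_def powr_powr powr_minus)
  qed
  have A_nonneg: "A k \<ge> 0" if "k \<ge> 1" for k
    using that r powr_mono[of "- r" 0 "real k"] by (simp add: A_def)
  have mean_nonneg: "mean x i \<ge> 0" for i
    by (simp add: mean_def x_nonneg sum_nonneg)

  have b_ge: "b k \<ge> 2 * A k powr p * inverse (real k)" if "k \<ge> 1" for k
  proof -
    have "A k * y k = (real k powr r - 1) / r / (2 * real k + 1)"
    proof -
      have "real k * y k = real k powr r"
        using that powr_add[of "real k" 1 "r - 1"] by (simp add: y_def)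
      moreover have "real k powr (- r) * real k powr r = 1"
        using that by (simp add: powr_minus)
      ultimately have "(1 - real k powr (- r)) * (real k * y k) = real k powr r - 1"
        by (simp add: left_diff_distrib)
      then show ?thesis
        by (simp add: A_def mult_ac)
    qed
    also have "\<dots> \<le> (\<Sum>j = 1..k. y j) / (2 * real k + 1)"
    proof (rule divide_right_mono)
      have "(real k powr r - 1) / r \<le> ((real k + 1) powr r - 1) / r"
        using r by (intro divide_right_mono diff_right_mono powr_mono2) auto
      also have "\<dots> \<le> (\<Sum>j = 1..k. y j)"
        unfolding y_def by (rule sum_powr_lower_bound[OF r(1,2)])
      finally show "(real k powr r - 1) / r \<le> (\<Sum>j = 1..k. y j)" .
    qed simp
    finally have lower: "A k * y k \<le> (\<Sum>j = 1..k. y j) / (2 * real k + 1)" .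
    also have "\<dots> \<le> (\<Sum>j = 1..k. y j) / (2 * real k)"
      using that by (intro divide_left_mono sum_nonneg y_nonneg) auto
    finally have "A k * y k \<le> mean x (2 * k)" "A k * y k \<le> mean x (2 * k + 1)"
      using lower unfolding x_def mean_interleave_zeros by auto
    then have "(A k * y k) powr p \<le> mean x (2 * k) powr p"
      "(A k * y k) powr p \<le> mean x (2 * k + 1) powr p"
      using assms(1) A_nonneg[OF that] y_nonneg by (auto intro!: powr_mono2)
    moreover have "(A k * y k) powr p = A k powr p * inverse (real k)"
      using A_nonneg[OF that] y_nonneg by (simp add: powr_mult y_powr)
    ultimately show ?thesis
      by (simp add: b_def)
  qed

  have "C \<ge> 2 * (1 / r * (1 / 2)) powr p"
  proof (rule ratio_bound_ge_limit[where a = "\<lambda>k. 2 * A k powr p" and b = b and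
        c = "\<lambda>k. inverse (real k)"])
    show "filterlim (\<lambda>N. \<Sum>k = 1..N. inverse (real k)) at_top sequentially"
      using harm_at_top by (simp add: harm_def[abs_def])
    have "(\<lambda>k. real k powr (- r)) \<longlonglongrightarrow> 0"
      using r(1) by (intro tendsto_neg_powr filterlim_real_sequentially) auto
    then have "(\<lambda>k. (1 - real k powr (- r)) / r) \<longlonglongrightarrow> (1 - 0) / r"
      using r(1) by (intro tendsto_intros) auto
    moreover have "(\<lambda>k. real k / (2 * real k + 1)) \<longlonglongrightarrow> 1 / 2"
      by real_asymp
    ultimately have "A \<longlonglongrightarrow> 1 / r * (1 / 2)"
      unfolding A_def using tendsto_mult by fastforce
    then show "(\<lambda>k. 2 * A k powr p) \<longlonglongrightarrow> 2 * (1 / r * (1 / 2)) powr p"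
      using r(1) by (intro tendsto_intros) auto
    show "(\<Sum>k = 1..N. b k) \<le> C * (\<Sum>k = 1..N. inverse (real k))" for N
    proof -
      let ?n = "2 * N + 1"
      have "(\<Sum>k = 1..N. b k) \<le> (\<Sum>i = 1..?n. mean x i powr p)"
        unfolding sum_pairs b_def by simp
      also have "\<dots> = (\<Sum>i = 1..?n. \<bar>lower_median x i - mean x i\<bar> powr p)"
        using mean_nonneg lower_median_interleave_zeros[of _ y] y_nonneg
        by (intro sum.cong) (auto simp: x_def)
      also have "\<dots> \<le> C * (\<Sum>i = 1..?n. x i powr p)"
        using x_nonneg by (intro assms(2)) auto
      also have "(\<Sum>i = 1..?n. x i powr p) = (\<Sum>k = 1..N. inverse (real k))"
        unfolding sum_pairs x_def
        using interleave_zeros_Suc_double[of y 0] by (simp add: y_powr)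
      finally show ?thesis .
    qed
  qed (use b_ge in auto)
  also have "2 * (1 / r * (1 / 2)) powr p = 2 powr (1 - p) * (p / (p - 1)) powr p"
  proof -
    have "(1 / r * (1 / 2)) powr p = (1 / r) powr p * (1 / 2) powr p"
      by (rule powr_mult)
    moreover have "1 / r = p / (p - 1)"
      using assms(1) by (simp add: r_def field_simps)
    moreover have "2 * (1 / 2) powr p = (2::real) powr (1 - p)"
      by (simp add: powr_diff powr_divide)
    ultimately show ?thesis
      by simp
  qed
  finally show ?thesis .
qed

end
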